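(* Let $r$ be a complex number and $n\ge0$ an integer. Then, as polynomials in $x$, $$D_n^{(r)}(x)=x^n-\sum_{k=1}^{n-1}k(k+2r)D_{k-1}^{(r)}(x)\,x^{n-1-k}$$ and $$n!\,d_n^{(r)}(x)=(1+2x)^n+\sum_{k=1}^{n-1}(k+2r)\,k!\,d_{k-1}^{(r)}(x)(1+2x)^{n-1-k}.$$
   Context: For a complex number $a$ and integer $k\ge0$, $\binom{a}{k}=a(a-1)\cdots(a-k+1)/k!$. For a parameter $r$ and an integer $n\ge 0$, $d_n^{(r)}(x)=\sum_{k=0}^n\binom{x+r+k}{k}\binom{x-r}{n-k}$. The polynomials $D_n^{(r)}(x)$ are defined by $D_{-1}^{(r)}(x)=0$, $D_0^{(r)}(x)=1$ and $D_{n+1}^{(r)}(x)=xD_n^{(r)}(x)-n(n+2r)D_{n-1}^{(r)}(x)$ for $n\ge0$. *)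

theory Defs
  imports Complex_Main "HOL-Computational_Algebra.Polynomial"
begin

(* gchoose is constrained to field_char_0.  This is its defining formula with a
   polynomial as the upper argument; see poly_binom_poly. *)
definition binom_poly :: "complex poly \<Rightarrow> nat \<Rightarrow> complex poly" where
  "binom_poly p k = smult (1 / fact k) (\<Prod>i=0..<k. p - of_nat i)"

definition dpoly :: "complex \<Rightarrow> nat \<Rightarrow> complex poly" where
  "dpoly r n =
     (\<Sum>k=0..n. binom_poly [:r + of_nat k, 1:] k * binom_poly [:- r, 1:] (n - k))"

(* D_{-1} = 0 has no index in nat; it would only enter D_1, with factor 0.
   See Dpoly_rec. *)
fun Dpoly :: "complex \<Rightarrow> nat \<Rightarrow> complex poly" where
  "Dpoly r 0 = 1"
| "Dpoly r (Suc 0) = [:0, 1:]"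
| "Dpoly r (Suc (Suc n)) =
     [:0, 1:] * Dpoly r (Suc n) - smult (of_nat (Suc n) * (of_nat (Suc n) + 2 * r)) (Dpoly r n)"

lemma Dpoly_rec:
  "Dpoly r (n + 1) =
     [:0, 1:] * Dpoly r n
       - smult (of_nat n * (of_nat n + 2 * r)) (if n = 0 then 0 else Dpoly r (n - 1))"
  by (cases n) simp_all

lemma poly_binom_poly: "poly (binom_poly p k) x = (poly p x gchoose k)"
  by (simp add: binom_poly_def gbinomial_prod_rev poly_prod of_nat_poly)

lemma poly_dpoly:
  "poly (dpoly r n) x =
     (\<Sum>k=0..n. (x + r + of_nat k gchoose k) * (x - r gchoose (n - k)))"
  by (simp add: dpoly_def poly_sum poly_binom_poly algebra_simps)

end

theory Submission
  imports Defs "HOL-Computational_Algebra.Formal_Power_Series"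
begin

unbundle fps_syntax

(*
  Both families satisfy a recurrence a (n + 1) = y a n + c n with a 0 = 1 and c 0 = 0, and
  unrolling it gives a n = y^n + sum c k y^(n-1-k).  For D this is the definition.  For d the
  recurrence
    (n + 1) d_(n+1) = (1 + 2x) d_n + (n + 2r) d_(n-1)
  is read off the logarithmic derivative of the generating function
    F(t) = (1 - t)^(-x-r-1) (1 + t)^(x-r),
  namely (1 - t^2) F' = ((1 + 2x) + (1 + 2r) t) F.
*)

text \<open>The first step is the separate hypothesis \<open>a 1 = y\<close>, so the value
  \<open>c 0\<close> is left free; the instances below contain \<open>k - 1\<close>, which truncates
  at k = 0.\<close>

lemma linear_recurrence_unroll:
  fixes a c :: "nat \<Rightarrow> 'a :: comm_semiring_1"
  assumes "a 0 = 1" "a 1 = y" "\<And>m. a (Suc (Suc m)) = y * a (Suc m) + c (Suc m)"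
  shows "a n = y ^ n + (\<Sum>k=1..n - 1. c k * y ^ (n - 1 - k))"
proof (cases n)
  case (Suc m)
  have "a (Suc m) = y ^ Suc m + (\<Sum>k=1..m. c k * y ^ (m - k))"
  proof (induction m)
    case (Suc m)
    \<comment> \<open>Multiplying by \<open>y\<close> raises every exponent by one; the
      inhomogeneity \<open>c (Suc m)\<close> then becomes the new last term, with exponent
      0.\<close>
    have "y * (\<Sum>k=1..m. c k * y ^ (m - k)) = (\<Sum>k=1..m. c k * y ^ (Suc m - k))"
      unfolding sum_distrib_left by (rule sum.cong) (auto simp: Suc_diff_le algebra_simps)
    with Suc show ?case
      by (simp add: assms(3) distrib_left add.assoc)
  qed (use assms(2) in simp)
  with Suc show ?thesis by simp
qed (use assms(1) in simp)

text \<open>\<open>G\<close> is the expansion of (1 - t)^(-a-1), and comparing coefficients leaves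
  only the ratio (a + k + 1) / (k + 1) of neighbouring ones.\<close>

lemma fps_deriv_gbinomial_diagonal:
  fixes a :: "'a :: field_char_0"
  defines "G \<equiv> Abs_fps (\<lambda>k. a + of_nat k gchoose k)"
  shows "(1 - fps_X) * fps_deriv G = fps_const (a + 1) * G"
proof (rule fps_ext)
  have step: "of_nat (Suc k) * G $ Suc k = (a + of_nat (Suc k)) * G $ k" for k
    using Suc_times_gbinomial[of k "a + of_nat k"] by (simp add: G_def add_ac)
  show "((1 - fps_X) * fps_deriv G) $ n = (fps_const (a + 1) * G) $ n" for n
    using step[of n] by (cases n) (simp_all add: algebra_simps)
qed

text \<open>\<open>H\<close> is the binomial series (1 + t)^b.\<close>

lemma fps_deriv_gbinomial:
  fixes b :: "'a :: field_char_0"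
  defines "H \<equiv> Abs_fps (\<lambda>k. b gchoose k)"
  shows "(1 + fps_X) * fps_deriv H = fps_const b * H"
proof (rule fps_ext)
  have step: "of_nat (Suc k) * H $ Suc k = (b - of_nat k) * H $ k" for k
    using gbinomial_mult_1[of b k] by (simp add: H_def algebra_simps)
  show "((1 + fps_X) * fps_deriv H) $ n = (fps_const b * H) $ n" for n
    using step[of n] by (cases n) (simp_all add: algebra_simps)
qed

lemma poly_dpoly_recurrence:
  shows "poly (dpoly r 0) x = 1"
    and "poly (dpoly r (Suc 0)) x = 1 + 2 * x"
    and "of_nat (Suc (Suc m)) * poly (dpoly r (Suc (Suc m))) x =
           (1 + 2 * x) * poly (dpoly r (Suc m)) x + (of_nat (Suc m) + 2 * r) * poly (dpoly r m) x"
proof -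
  define G where "G = Abs_fps (\<lambda>k. (x + r) + of_nat k gchoose k)"
  define H where "H = Abs_fps (\<lambda>k. (x - r) gchoose k)"
  define F where "F = G * H"
  have G: "(1 - fps_X) * fps_deriv G = fps_const (x + r + 1) * G"
    unfolding G_def by (rule fps_deriv_gbinomial_diagonal)
  have H: "(1 + fps_X) * fps_deriv H = fps_const (x - r) * H"
    unfolding H_def by (rule fps_deriv_gbinomial)
  \<comment> \<open>The Cauchy product of the two series is the defining sum of d_n.\<close>
  have F_nth: "F $ n = poly (dpoly r n) x" for n
    by (simp add: F_def G_def H_def fps_mult_nth poly_dpoly)
  \<comment> \<open>By the product rule, 1 - t^2 supplies each summand with the factor that its own
    differential equation requires.\<close>
  have "(1 - fps_X) * (1 + fps_X) * fps_deriv F =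
      (1 + fps_X) * H * ((1 - fps_X) * fps_deriv G) + (1 - fps_X) * G * ((1 + fps_X) * fps_deriv H)"
    by (simp add: F_def algebra_simps)
  also have "\<dots> = fps_const (x + r + 1) * (F + fps_X * F) + fps_const (x - r) * (F - fps_X * F)"
    unfolding G H by (simp add: F_def algebra_simps)
  finally have ode: "fps_deriv F - fps_X * (fps_X * fps_deriv F) =
      fps_const (x + r + 1) * (F + fps_X * F) + fps_const (x - r) * (F - fps_X * F)"
    by (simp add: algebra_simps)
  show 0: "poly (dpoly r 0) x = 1"
    by (simp add: poly_dpoly)
  show "poly (dpoly r (Suc 0)) x = 1 + 2 * x"
    using arg_cong[OF ode, of "\<lambda>f. f $ 0"] by (simp add: F_nth 0)
  show "of_nat (Suc (Suc m)) * poly (dpoly r (Suc (Suc m))) x =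
      (1 + 2 * x) * poly (dpoly r (Suc m)) x + (of_nat (Suc m) + 2 * r) * poly (dpoly r m) x"
  proof -
    \<comment> \<open>The term \<open>of_nat m * F $ m\<close> comes from t^2 F', also for m = 0,
      where both vanish. Moved to the right, it turns (x + r + 1) - (x - r) = 1 + 2r into m + 1 +
      2r.\<close>
    have "of_nat (Suc (Suc m)) * F $ Suc (Suc m) - of_nat m * F $ m =
        (x + r + 1) * (F $ Suc m + F $ m) + (x - r) * (F $ Suc m - F $ m)"
      using arg_cong[OF ode, of "\<lambda>f. f $ Suc m"] by (cases m) simp_all
    then show ?thesis
      by (simp add: F_nth algebra_simps)
  qed
qed

text \<open>Scaling by (m + 1)! absorbs the leading factor m + 2 into (m + 2)!. The identity at
  every point x lifts to polynomials because the complex field is infinite.\<close>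

lemma fact_dpoly_recurrence:
  shows "smult (fact 0) (dpoly r 0) = 1"
    and "smult (fact 1) (dpoly r 1) = [:1, 2:]"
    and "smult (fact (Suc (Suc m))) (dpoly r (Suc (Suc m))) =
           [:1, 2:] * smult (fact (Suc m)) (dpoly r (Suc m))
           + smult ((of_nat (Suc m) + 2 * r) * fact (Suc m)) (dpoly r m)"
proof -
  show "smult (fact 0) (dpoly r 0) = 1" "smult (fact 1) (dpoly r 1) = [:1, 2:]"
    by (auto simp: poly_eq_poly_eq_iff[symmetric] fun_eq_iff poly_dpoly_recurrence)
  have "fact (Suc (Suc m)) * poly (dpoly r (Suc (Suc m))) x =
      fact (Suc m) * (of_nat (Suc (Suc m)) * poly (dpoly r (Suc (Suc m))) x)" for x
    by (simp only: fact_Suc[of "Suc m"] mult_ac)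
  then have "fact (Suc (Suc m)) * poly (dpoly r (Suc (Suc m))) x =
      (1 + x * 2) * (fact (Suc m) * poly (dpoly r (Suc m)) x) +
      (of_nat (Suc m) + 2 * r) * fact (Suc m) * poly (dpoly r m) x" for x
    unfolding poly_dpoly_recurrence by (simp only: distrib_left mult_ac)
  then show "smult (fact (Suc (Suc m))) (dpoly r (Suc (Suc m))) =
      [:1, 2:] * smult (fact (Suc m)) (dpoly r (Suc m))
      + smult ((of_nat (Suc m) + 2 * r) * fact (Suc m)) (dpoly r m)"
    by (simp add: poly_eq_poly_eq_iff[symmetric] fun_eq_iff del: fact_Suc of_nat_Suc mult_smult_right mult_pCons_left)
qed

theorem theorem3p5:
  fixes r :: complex and n :: nat
  shows "Dpoly r n = [:0, 1:] ^ n
           - (\<Sum>k=1..n - 1. smult (of_nat k * (of_nat k + 2 * r))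
                (Dpoly r (k - 1) * [:0, 1:] ^ (n - 1 - k)))
       \<and> smult (fact n) (dpoly r n) = [:1, 2:] ^ n
           + (\<Sum>k=1..n - 1. smult ((of_nat k + 2 * r) * fact k)
                (dpoly r (k - 1) * [:1, 2:] ^ (n - 1 - k)))"
proof
  show "Dpoly r n = [:0, 1:] ^ n
      - (\<Sum>k=1..n - 1. smult (of_nat k * (of_nat k + 2 * r))
           (Dpoly r (k - 1) * [:0, 1:] ^ (n - 1 - k)))"
    \<comment> \<open>The minus sign of the recurrence is put into \<open>c\<close> and pulled out
      of the sum afterwards.\<close>
    using linear_recurrence_unroll[of "Dpoly r" "[:0, 1:]"
        "\<lambda>k. - smult (of_nat k * (of_nat k + 2 * r)) (Dpoly r (k - 1))" n]
    by (simp add: sum_negf del: mult_pCons_left)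
  show "smult (fact n) (dpoly r n) = [:1, 2:] ^ n
      + (\<Sum>k=1..n - 1. smult ((of_nat k + 2 * r) * fact k)
           (dpoly r (k - 1) * [:1, 2:] ^ (n - 1 - k)))"
    using linear_recurrence_unroll[of "\<lambda>n. smult (fact n) (dpoly r n)" "[:1, 2:]"
        "\<lambda>k. smult ((of_nat k + 2 * r) * fact k) (dpoly r (k - 1))" n]
      fact_dpoly_recurrence[where r = r]
    by (simp del: fact_Suc of_nat_Suc mult_smult_right mult_pCons_left)
qed

end
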